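(* Let $k$ and $h$ be positive integers with $1\leq h\leq k$, and let $A$ be a finite set of $k$ non-negative integers with $0\in A$. Then $$|h\hat{}_{\underline{+}}A| \geq 2(hk-h^2)+\binom{h}{2}+1.$$ Moreover, this lower bound is best possible for $h=1$, $h=2$ and $h=k$; that is, for every positive integer $k$ and every $h\in\{1,2,k\}$ with $h\leq k$, there exists a set $A$ of $k$ non-negative integers with $0\in A$ for which equality holds.
   Context: For a finite set $A=\{a_0,a_1,\ldots,a_{k-1}\}$ of $k$ distinct integers and an integer $1\leq h\leq k$, the $h$-fold restricted signed sumset of $A$ is $$h\hat{}_{\underline{+}}A:=\Big\{\sum_{i=0}^{k-1}\lambda_i a_i : (\lambda_0,\ldots,\lambda_{k-1})\in\{-1,0,1\}^k,\ \sum_{i=0}^{k-1}|\lambda_i|=h\Big\}.$$ $|S|$ denotes the cardinality of a finite set $S$. The binomial coefficient $\binom{a}{b}$ is $\frac{a!}{b!(a-b)!}$ if $a\geq b$ and $0$ otherwise. *)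

theory Defs
  imports Complex_Main
begin

text \<open>
  The elements of \<open>A\<close> are distinct, so a coefficient vector indexed by \<open>0, ..., k - 1\<close>
  is the same as a coefficient function on \<open>A\<close>; only its values on \<open>A\<close> matter.
\<close>

definition restricted_signed_sumset :: "nat \<Rightarrow> int set \<Rightarrow> int set" where
  "restricted_signed_sumset h A =
     {\<Sum>a\<in>A. c a * a | c :: int \<Rightarrow> int.
        (\<forall>a\<in>A. c a \<in> {-1, 0, 1}) \<and> (\<Sum>a\<in>A. \<bar>c a\<bar>) = int h}"

end

theory Submission
  imports Defs
begin

text \<open>
  Write a signed sum as \<open>\<Sum>P - \<Sum>N\<close> with \<open>P\<close>, \<open>N\<close> disjoint subsets of \<open>A\<close> having \<open>h\<close> elements
  in total, put \<open>k = card A\<close>, and let \<open>f k h = 2 (h k - h\<^sup>2) + (h choose 2) + 1\<close> be the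
  claimed bound.  It satisfies \<open>f (k + 1) h = f k h + 2 h\<close> and \<open>f (k + 1) (k + 1) = f k k + k\<close>, and
  the lower bound is proved by adding the elements of \<open>A\<close> in increasing order, each new element \<open>b\<close> contributing at least as
  many new sums as these recurrences ask for.

  Let \<open>A\<close> be the set of elements added so far, \<open>k\<close> its size and \<open>b\<close> the next, larger element.
  If \<open>h \<le> k\<close>, let \<open>T\<close> be an \<open>h\<close>-subset of \<open>A\<close> with the largest sum.  Every old signed sum lies in
  \<open>[-\<Sum>T, \<Sum>T]\<close>.  Exchanging some \<open>t \<in> T\<close> for \<open>b\<close> gives \<open>h\<close> distinct sums above \<open>\<Sum>T\<close>, and their
  negatives are \<open>h\<close> further sums below \<open>-\<Sum>T\<close> (\<open>card_insert_above\<close>).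

  If \<open>h = k + 1\<close>, every element must be used.  Giving \<open>b\<close> the sign \<open>-1\<close> yields a translate of the
  old full signed sumset, all of it at most \<open>\<Sum>A - b\<close>.  Giving \<open>b\<close> the sign \<open>+1\<close> and a single
  \<open>t \<in> A\<close> the sign \<open>-1\<close> yields \<open>\<Sum>A + b - 2 t > \<Sum>A - b\<close>, which makes \<open>k\<close> new sums
  (\<open>card_insert_full\<close>).

  The induction starts at \<open>A = {0}\<close>, whose only sum is \<open>0\<close>.

  Equality holds for \<open>A = {0, ..., k - 1}\<close>: for \<open>h = 1\<close> and \<open>h = 2\<close> the largest sum bounds the
  sumset, with \<open>0\<close> missing for \<open>h = 2\<close>; for \<open>h = k\<close> all sums have the parity of \<open>\<Sum>A\<close>.
\<close>

section \<open>Signed sums as differences of subset sums\<close>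

lemma restricted_signed_sumset_eq:
  assumes "finite A"
  shows "restricted_signed_sumset h A =
    {\<Sum>P - \<Sum>N | P N. P \<subseteq> A \<and> N \<subseteq> A \<and> P \<inter> N = {} \<and> card P + card N = h}" (is "?L = ?R")
proof
  show "?L \<subseteq> ?R"
  proof
    fix s assume "s \<in> ?L"
    then obtain c where s: "s = (\<Sum>a\<in>A. c a * a)" and c: "\<forall>a\<in>A. c a \<in> {-1, 0, 1}"
      and h: "(\<Sum>a\<in>A. \<bar>c a\<bar>) = int h"
      unfolding restricted_signed_sumset_def by blast
    define P where "P = {a \<in> A. c a = 1}"
    define N where "N = {a \<in> A. c a = -1}"
    have PN: "P \<subseteq> A" "N \<subseteq> A" "P \<inter> N = {}"
      by (auto simp: P_def N_def)
    have "s = (\<Sum>a\<in>A. (if c a = 1 then a else 0) - (if c a = -1 then a else 0))"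
      unfolding s by (rule sum.cong) (use c in auto)
    also have "\<dots> = \<Sum>P - \<Sum>N"
      unfolding P_def N_def sum_subtractf
      by (simp add: sum.If_cases assms Int_def)
    finally have sPN: "s = \<Sum>P - \<Sum>N" .
    have "(\<Sum>a\<in>A. \<bar>c a\<bar>) = (\<Sum>a\<in>A. (if c a = 1 then 1 else 0) + (if c a = -1 then 1 else 0))"
      by (rule sum.cong) (use c in auto)
    also have "\<dots> = int (card P + card N)"
      unfolding P_def N_def sum.distrib
      by (simp add: sum.If_cases assms Int_def)
    finally have "card P + card N = h"
      using h by linarith
    with sPN PN show "s \<in> ?R" by blast
  qed
next
  show "?R \<subseteq> ?L"
  proof
    fix s assume "s \<in> ?R"
    then obtain P N where s: "s = \<Sum>P - \<Sum>N" and P: "P \<subseteq> A" and N: "N \<subseteq> A"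
      and d: "P \<inter> N = {}" and h: "card P + card N = h" by blast
    define c :: "int \<Rightarrow> int" where "c a = (if a \<in> P then 1 else 0) - (if a \<in> N then 1 else 0)" for a
    have "(\<Sum>a\<in>A. c a * a) = (\<Sum>a\<in>A. (if a \<in> P then a else 0) - (if a \<in> N then a else 0))"
      by (rule sum.cong) (auto simp: c_def)
    also have "\<dots> = s"
      unfolding s sum_subtractf using P N
      by (simp add: sum.If_cases assms Int_absorb1 Int_absorb2)
    finally have 1: "(\<Sum>a\<in>A. c a * a) = s" .
    have "(\<Sum>a\<in>A. \<bar>c a\<bar>) = (\<Sum>a\<in>A. (if a \<in> P then 1 else 0) + (if a \<in> N then 1 else 0))"
      by (rule sum.cong) (use d in \<open>auto simp: c_def\<close>)
    also have "\<dots> = int h"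
      unfolding h[symmetric] sum.distrib using P N
      by (simp add: sum.If_cases assms Int_absorb1 Int_absorb2)
    finally have 2: "(\<Sum>a\<in>A. \<bar>c a\<bar>) = int h" .
    have "\<forall>a\<in>A. c a \<in> {-1, 0, 1}"
      using d by (auto simp: c_def)
    with 1 2 show "s \<in> ?L"
      unfolding restricted_signed_sumset_def by blast
  qed
qed

lemma signed_sumI:
  assumes "finite A" "P \<subseteq> A" "N \<subseteq> A" "P \<inter> N = {}" "card P + card N = h" "s = \<Sum>P - \<Sum>N"
  shows "s \<in> restricted_signed_sumset h A"
  unfolding restricted_signed_sumset_eq[OF assms(1)] using assms by blast

lemma signed_sumE:
  assumes "s \<in> restricted_signed_sumset h A" "finite A"
  obtains P N where "P \<subseteq> A" "N \<subseteq> A" "P \<inter> N = {}" "card P + card N = h" "s = \<Sum>P - \<Sum>N"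
  using assms(1) unfolding restricted_signed_sumset_eq[OF assms(2)] by blast

lemma finite_restricted_signed_sumset:
  assumes "finite A"
  shows "finite (restricted_signed_sumset h A)"
proof (rule finite_subset)
  show "restricted_signed_sumset h A \<subseteq> (\<lambda>(P, N). \<Sum>P - \<Sum>N) ` (Pow A \<times> Pow A)"
    by (fastforce elim: signed_sumE[OF _ assms])
qed (use assms in auto)

lemma uminus_restricted_signed_sumset:
  assumes "s \<in> restricted_signed_sumset h A" "finite A"
  shows "- s \<in> restricted_signed_sumset h A"
proof -
  obtain P N where "P \<subseteq> A" "N \<subseteq> A" "P \<inter> N = {}" "card P + card N = h" "s = \<Sum>P - \<Sum>N"
    using assms by (rule signed_sumE)
  then show ?thesis
    by (intro signed_sumI[where P = N and N = P]) (auto simp: assms)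
qed

lemma restricted_signed_sumset_mono:
  assumes "finite B" "A \<subseteq> B"
  shows "restricted_signed_sumset h A \<subseteq> restricted_signed_sumset h B"
proof
  fix s assume "s \<in> restricted_signed_sumset h A"
  then obtain P N where "P \<subseteq> A" "N \<subseteq> A" "P \<inter> N = {}" "card P + card N = h" "s = \<Sum>P - \<Sum>N"
    using finite_subset[OF assms(2,1)] by (rule signed_sumE)
  then show "s \<in> restricted_signed_sumset h B"
    using assms by (intro signed_sumI[where P = P and N = N]) auto
qed

lemma signed_sum_abs_le:
  assumes "s \<in> restricted_signed_sumset h A" "finite A" "\<forall>a\<in>A. 0 \<le> a"
  obtains X where "X \<subseteq> A" "card X = h" "\<bar>s\<bar> \<le> \<Sum>X"
proof -
  obtain P N where PN: "P \<subseteq> A" "N \<subseteq> A" "P \<inter> N = {}" "card P + card N = h" "s = \<Sum>P - \<Sum>N"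
    using assms(1,2) by (rule signed_sumE)
  have fin: "finite P" "finite N"
    using PN assms(2) finite_subset by blast+
  have "0 \<le> \<Sum>P" "0 \<le> \<Sum>N"
    using PN assms(3) by (auto intro!: sum_nonneg)
  moreover have "\<Sum>(P \<union> N) = \<Sum>P + \<Sum>N"
    using fin PN(3) by (rule sum.union_disjoint)
  ultimately have "\<bar>s\<bar> \<le> \<Sum>(P \<union> N)"
    using PN(5) by linarith
  moreover have "card (P \<union> N) = h"
    using card_Un_disjoint[OF fin PN(3)] PN(4) by simp
  ultimately show thesis
    using PN(1,2) by (intro that[of "P \<union> N"]) auto
qed

lemma obtain_subset_of_max_sum:
  fixes A :: "int set"
  assumes "finite A" "h \<le> card A"
  obtains T where "T \<subseteq> A" "card T = h" "\<And>X. X \<subseteq> A \<Longrightarrow> card X = h \<Longrightarrow> \<Sum>X \<le> \<Sum>T"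
proof -
  let ?F = "{X. X \<subseteq> A \<and> card X = h}"
  have fin: "finite (Sum ` ?F)"
    using assms(1) by simp
  have "?F \<noteq> {}"
    using obtain_subset_with_card_n[OF assms(2)] by blast
  then have "Max (Sum ` ?F) \<in> Sum ` ?F"
    using fin by (intro Max_in) auto
  then obtain T where "T \<in> ?F" "\<Sum>T = Max (Sum ` ?F)"
    by auto
  then show thesis
    using that[of T] Max_ge[OF fin] by auto
qed

section \<open>New sums from a new maximum\<close>

text \<open>
  Exchanging one element of a best \<open>h\<close>-subset for the new maximum \<open>b\<close> beats every old sum, in \<open>h\<close>
  different ways; the negatives of these sums lie below every old sum.
\<close>

lemma card_insert_above:
  assumes A: "finite A" "\<forall>a\<in>A. 0 \<le> a" and b: "\<forall>a\<in>A. a < b" and h: "h \<le> card A"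
  shows "card (restricted_signed_sumset h A) + 2 * h
    \<le> card (restricted_signed_sumset h (insert b A))"
proof -
  let ?S = "restricted_signed_sumset h A" and ?S' = "restricted_signed_sumset h (insert b A)"
  obtain T where T: "T \<subseteq> A" "card T = h"
    and max: "\<And>X. X \<subseteq> A \<Longrightarrow> card X = h \<Longrightarrow> \<Sum>X \<le> \<Sum>T"
    using obtain_subset_of_max_sum[OF A(1) h] by blast
  have finT: "finite T"
    using T A(1) finite_subset by blast
  have T0: "0 \<le> \<Sum>T"
    using T A by (auto intro!: sum_nonneg)
  define U where "U = (\<lambda>t. \<Sum>T - t + b) ` T"
  have above: "\<forall>u\<in>U. \<Sum>T < u"
    using T b by (fastforce simp: U_def)
  have old: "\<forall>s\<in>?S. \<bar>s\<bar> \<le> \<Sum>T"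
  proof
    fix s assume "s \<in> ?S"
    then obtain X where "X \<subseteq> A" "card X = h" "\<bar>s\<bar> \<le> \<Sum>X"
      using A by (rule signed_sum_abs_le)
    then show "\<bar>s\<bar> \<le> \<Sum>T"
      using max[of X] by linarith
  qed
  have U: "U \<subseteq> ?S'"
  proof
    fix u assume "u \<in> U"
    then obtain t where t: "t \<in> T" "u = \<Sum>T - t + b"
      by (auto simp: U_def)
    have bT: "b \<notin> T - {t}"
      using T b by auto
    show "u \<in> ?S'"
    proof (rule signed_sumI[where P = "insert b (T - {t})" and N = "{}"])
      show "card (insert b (T - {t})) + card {} = h"
        using bT t T(2) finT card_Suc_Diff1[OF finT t(1)] by simp
      show "u = \<Sum>(insert b (T - {t})) - \<Sum>{}"
        using bT t finT by (simp add: sum_diff1)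
    qed (use T A in auto)
  qed
  have U': "uminus ` U \<subseteq> ?S'"
    using U uminus_restricted_signed_sumset A(1) by blast
  have S: "?S \<subseteq> ?S'"
    using A by (intro restricted_signed_sumset_mono) auto
  have fin: "finite ?S" "finite U" "finite (uminus ` U)"
    using finT A by (auto simp: U_def finite_restricted_signed_sumset)
  have cU: "card U = h" "card (uminus ` U) = h"
    using T(2) by (auto simp: U_def card_image inj_on_def)
  have d1: "?S \<inter> U = {}"
    using above old by fastforce
  have d2: "(?S \<union> U) \<inter> uminus ` U = {}"
  proof -
    have below: "\<forall>v\<in>uminus ` U. v < - \<Sum>T"
      using above by auto
    have "- \<Sum>T \<le> s" if "s \<in> ?S \<union> U" for s
      using that
    proof
      assume "s \<in> ?S"
      then have "\<bar>s\<bar> \<le> \<Sum>T"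
        using old by blast
      then show ?thesis
        by linarith
    next
      assume "s \<in> U"
      then have "\<Sum>T < s"
        using above by blast
      then show ?thesis
        using T0 by linarith
    qed
    then show ?thesis
      using below by (meson disjoint_iff not_le)
  qed
  have "card ?S + 2 * h = card (?S \<union> U \<union> uminus ` U)"
    using fin d1 d2 cU by (simp add: card_Un_disjoint)
  also have "\<dots> \<le> card ?S'"
    using S U U' A by (intro card_mono) (auto simp: finite_restricted_signed_sumset)
  finally show ?thesis .
qed

text \<open>
  When all elements are used, the sums with \<open>b\<close> taken negatively form a translate of the old
  sumset, and flipping one sign of \<open>\<Sum>A + b\<close> costs at most \<open>2 t < 2 b\<close>, hence stays above that
  translate.
\<close>

lemma card_insert_full:
  assumes A: "finite A" "\<forall>a\<in>A. 0 \<le> a" and b: "\<forall>a\<in>A. a < b"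
  shows "card (restricted_signed_sumset (card A) A) + card A
    \<le> card (restricted_signed_sumset (Suc (card A)) (insert b A))"
proof -
  let ?S = "restricted_signed_sumset (card A) A"
  let ?S' = "restricted_signed_sumset (Suc (card A)) (insert b A)"
  have bA: "b \<notin> A"
    using b by auto
  define U where "U = (\<lambda>t. \<Sum>A + b - 2 * t) ` A"
  define V where "V = (\<lambda>s. s - b) ` ?S"
  have above: "\<forall>u\<in>U. \<Sum>A - b < u"
    using b by (auto simp: U_def)
  have old: "\<forall>v\<in>V. v \<le> \<Sum>A - b"
  proof
    fix v assume "v \<in> V"
    then obtain s where s: "s \<in> ?S" "v = s - b"
      by (auto simp: V_def)
    obtain X where "X \<subseteq> A" "card X = card A" "\<bar>s\<bar> \<le> \<Sum>X"
      using signed_sum_abs_le[OF s(1) A] by blast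
    moreover from this have "X = A"
      using A(1) card_subset_eq by blast
    ultimately show "v \<le> \<Sum>A - b"
      using s(2) by simp
  qed
  have U: "U \<subseteq> ?S'"
  proof
    fix u assume "u \<in> U"
    then obtain t where t: "t \<in> A" "u = \<Sum>A + b - 2 * t"
      by (auto simp: U_def)
    have bt: "b \<notin> A - {t}"
      using bA by auto
    show "u \<in> ?S'"
    proof (rule signed_sumI[where P = "insert b (A - {t})" and N = "{t}"])
      show "card (insert b (A - {t})) + card {t} = Suc (card A)"
        using bt A(1) card_Suc_Diff1[OF A(1) t(1)] by simp
      show "u = \<Sum>(insert b (A - {t})) - \<Sum>{t}"
        using bt t A(1) by (simp add: sum_diff1)
      show "insert b (A - {t}) \<inter> {t} = {}"
        using t(1) bA by auto
    qed (use t A in auto)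
  qed
  have V: "V \<subseteq> ?S'"
  proof
    fix v assume "v \<in> V"
    then obtain s where s: "s \<in> ?S" "v = s - b"
      by (auto simp: V_def)
    obtain P N where PN: "P \<subseteq> A" "N \<subseteq> A" "P \<inter> N = {}" "card P + card N = card A"
      "s = \<Sum>P - \<Sum>N"
      using s(1) A(1) by (rule signed_sumE)
    have N: "b \<notin> N" "finite N"
      using PN bA A(1) finite_subset by blast+
    show "v \<in> ?S'"
    proof (rule signed_sumI[where P = P and N = "insert b N"])
      show "card P + card (insert b N) = Suc (card A)"
        using N PN(4) by simp
      show "v = \<Sum>P - \<Sum>(insert b N)"
        using N PN(5) s(2) by simp
      show "P \<inter> insert b N = {}"
        using PN bA by auto
    qed (use PN A in auto)
  qed
  have fin: "finite V" "finite U"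
    using A by (auto simp: U_def V_def finite_restricted_signed_sumset)
  have c: "card U = card A" "card V = card ?S"
    by (auto simp: U_def V_def card_image inj_on_def)
  have "V \<inter> U = {}"
    using above old by fastforce
  then have "card ?S + card A = card (V \<union> U)"
    using fin c by (simp add: card_Un_disjoint)
  also have "\<dots> \<le> card ?S'"
    using U V A by (intro card_mono) (auto simp: finite_restricted_signed_sumset)
  finally show ?thesis .
qed

section \<open>The lower bound\<close>

text \<open>
  Splitting off the element \<open>0\<close> lets the induction add the positive elements in increasing order,
  starting from \<open>A = {0}\<close>.
\<close>

lemma card_restricted_signed_sumset_insert_0:
  assumes "finite B" "\<forall>x\<in>B. 0 < x" "h \<le> Suc (card B)"
  shows "2 * (int h * int (Suc (card B)) - int h ^ 2) + int (h choose 2) + 1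
    \<le> int (card (restricted_signed_sumset h (insert 0 B)))"
  using assms
proof (induction B arbitrary: h rule: finite_linorder_max_induct)
  case empty
  have "0 \<in> restricted_signed_sumset h {0}"
  proof (cases h)
    case 0
    then show ?thesis
      by (intro signed_sumI[where P = "{}" and N = "{}"]) auto
  next
    case (Suc n)
    then show ?thesis
      using empty by (intro signed_sumI[where P = "{0}" and N = "{}"]) auto
  qed
  then have "0 < card (restricted_signed_sumset h {0})"
    by (auto simp: card_gt_0_iff finite_restricted_signed_sumset)
  moreover have "h = 0 \<or> h = 1"
    using empty by auto
  ultimately show ?case
    by (auto simp: binomial_eq_0)
next
  case (insert b B)
  let ?A = "insert 0 B"
  have A: "finite ?A" "\<forall>a\<in>?A. 0 \<le> a" and b: "\<forall>a\<in>?A. a < b"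
    using insert.hyps insert.prems by force+
  have bB: "b \<notin> B" and cA: "card ?A = Suc (card B)"
    using insert.hyps insert.prems by auto
  have eq: "insert 0 (insert b B) = insert b ?A"
    by auto
  have IH: "2 * (int j * int (Suc (card B)) - int j ^ 2) + int (j choose 2) + 1
    \<le> int (card (restricted_signed_sumset j ?A))" if "j \<le> Suc (card B)" for j
    using insert.IH insert.prems(1) that by simp
  show ?case
  proof (cases "h \<le> Suc (card B)")
    case True
    have "card (restricted_signed_sumset h ?A) + 2 * h
        \<le> card (restricted_signed_sumset h (insert b ?A))"
      using card_insert_above[OF A b] True cA by simp
    moreover have "2 * (int h * int (Suc (Suc (card B))) - int h ^ 2)
        = 2 * (int h * int (Suc (card B)) - int h ^ 2) + 2 * int h"
      by (simp add: algebra_simps)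
    ultimately show ?thesis
      using IH[OF True] insert.hyps bB unfolding eq by simp
  next
    case False
    then have h: "h = Suc (Suc (card B))"
      using insert.prems(2) insert.hyps bB by simp
    have "card (restricted_signed_sumset (Suc (card B)) ?A) + Suc (card B)
        \<le> card (restricted_signed_sumset h (insert b ?A))"
      using card_insert_full[OF A b] cA h by simp
    moreover have "h choose 2 = (Suc (card B) choose 2) + Suc (card B)"
      unfolding h by (simp add: numeral_2_eq_2)
    ultimately show ?thesis
      using IH[of "Suc (card B)"] insert.hyps bB h unfolding eq
      by (simp add: power2_eq_square)
  qed
qed

lemma card_restricted_signed_sumset_ge:
  assumes "finite A" "\<forall>a\<in>A. 0 \<le> a" "0 \<in> A" "h \<le> card A"
  shows "2 * (int h * int (card A) - int h ^ 2) + int (h choose 2) + 1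
    \<le> int (card (restricted_signed_sumset h A))"
proof -
  let ?B = "A - {0}"
  have A: "insert 0 ?B = A" "Suc (card ?B) = card A"
    using assms card_Suc_Diff1[of A 0] by auto
  have "\<forall>x\<in>?B. 0 < x"
    using assms(2) by force
  then show ?thesis
    using card_restricted_signed_sumset_insert_0[of ?B h] assms A by simp
qed

section \<open>Intervals attain the bound\<close>

lemma card_signed_sumset_1_interval_le:
  assumes "1 \<le> k"
  shows "int (card (restricted_signed_sumset 1 {0..<int k})) \<le> 2 * int k - 1"
proof -
  have "restricted_signed_sumset 1 {0..<int k} \<subseteq> {-(int k - 1)..int k - 1}"
  proof
    fix s assume "s \<in> restricted_signed_sumset 1 {0..<int k}"
    then obtain X where "X \<subseteq> {0..<int k}" "card X = 1" "\<bar>s\<bar> \<le> \<Sum>X"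
      by (rule signed_sum_abs_le) auto
    then show "s \<in> {-(int k - 1)..int k - 1}"
      by (auto simp: card_1_singleton_iff)
  qed
  then have "card (restricted_signed_sumset 1 {0..<int k}) \<le> card {-(int k - 1)..int k - 1}"
    by (intro card_mono) auto
  then show ?thesis
    using assms by simp
qed

lemma card_signed_sumset_2_interval_le:
  assumes "2 \<le> k"
  shows "int (card (restricted_signed_sumset 2 {0..<int k})) \<le> 4 * int k - 6"
proof -
  let ?I = "{-(2 * int k - 3)..2 * int k - 3}"
  have "restricted_signed_sumset 2 {0..<int k} \<subseteq> ?I - {0}"
  proof
    fix s assume s: "s \<in> restricted_signed_sumset 2 {0..<int k}"
    then obtain X where "X \<subseteq> {0..<int k}" "card X = 2" "\<bar>s\<bar> \<le> \<Sum>X"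
      by (rule signed_sum_abs_le) auto
    then obtain a b where "a \<noteq> b" "a \<in> {0..<int k}" "b \<in> {0..<int k}" "\<bar>s\<bar> \<le> a + b"
      by (auto simp: card_2_iff)
    then have "s \<in> ?I"
      by auto
    \<comment> \<open>two distinct non-negative integers have neither sum nor difference \<open>0\<close>\<close>
    moreover have "s \<noteq> 0"
    proof
      assume 0: "s = 0"
      obtain P N where PN: "P \<subseteq> {0..<int k}" "N \<subseteq> {0..<int k}" "P \<inter> N = {}"
        "card P + card N = 2" "s = \<Sum>P - \<Sum>N"
        using s by (rule signed_sumE) auto
      have fin: "finite P" "finite N"
        using PN finite_subset by blast+
      have eq: "\<Sum>P = \<Sum>N"
        using PN(5) 0 by simp
      consider "card P = 0" "card N = 2" | "card P = 1" "card N = 1" | "card P = 2" "card N = 0"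
        using PN(4) by linarith
      then show False
      proof cases
        case 1
        then obtain a b where "N = {a, b}" "a \<noteq> b"
          by (auto simp: card_2_iff)
        with 1 eq fin PN(2) show False
          by simp
      next
        case 2
        then obtain a b where "P = {a}" "N = {b}"
          by (metis card_1_singletonE)
        with eq PN(3) show False
          by simp
      next
        case 3
        then obtain a b where "P = {a, b}" "a \<noteq> b"
          by (auto simp: card_2_iff)
        with 3 eq fin PN(1) show False
          by simp
      qed
    qed
    ultimately show "s \<in> ?I - {0}"
      by simp
  qed
  then have "card (restricted_signed_sumset 2 {0..<int k}) \<le> card (?I - {0})"
    by (intro card_mono) auto
  moreover have "0 \<in> ?I"
    using assms by simp
  ultimately show ?thesis
    using assms by (simp add: card_Diff_singleton)
qed

lemma sum_interval_eq_choose: "\<Sum>{0..<int k} = int (k choose 2)"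
proof (induction k)
  case (Suc k)
  have "{0..<int (Suc k)} = insert (int k) {0..<int k}"
    by auto
  then show ?case
    using Suc by (simp add: numeral_2_eq_2)
qed simp

text \<open>
  A full signed sum \<open>\<Sum>A - 2 \<Sum>N\<close> is determined by \<open>\<Sum>N\<close>, an integer between \<open>0\<close> and \<open>\<Sum>A\<close>.
\<close>

lemma card_full_signed_sumset_le:
  assumes "finite A" "\<forall>a\<in>A. 0 \<le> a"
  shows "int (card (restricted_signed_sumset (card A) A)) \<le> \<Sum>A + 1"
proof -
  have "restricted_signed_sumset (card A) A \<subseteq> (\<lambda>j. \<Sum>A - 2 * j) ` {0..\<Sum>A}"
  proof
    fix s assume "s \<in> restricted_signed_sumset (card A) A"
    then obtain P N where PN: "P \<subseteq> A" "N \<subseteq> A" "P \<inter> N = {}" "card P + card N = card A"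
      "s = \<Sum>P - \<Sum>N"
      using assms(1) by (rule signed_sumE)
    have fin: "finite P" "finite N"
      using PN assms(1) finite_subset by blast+
    have "card (P \<union> N) = card A"
      using card_Un_disjoint[OF fin PN(3)] PN(4) by simp
    then have "P \<union> N = A"
      using PN assms(1) card_subset_eq[of A "P \<union> N"] by simp
    then have "\<Sum>A = \<Sum>P + \<Sum>N"
      using sum.union_disjoint[OF fin PN(3), of "\<lambda>x. x"] by simp
    moreover have "0 \<le> \<Sum>P" "0 \<le> \<Sum>N"
      using PN assms(2) by (auto intro!: sum_nonneg)
    ultimately show "s \<in> (\<lambda>j. \<Sum>A - 2 * j) ` {0..\<Sum>A}"
      using PN(5) by (intro image_eqI[of _ _ "\<Sum>N"]) auto
  qed
  then have "card (restricted_signed_sumset (card A) A) \<le> card {0..\<Sum>A}"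
    by (intro surj_card_le) auto
  moreover have "0 \<le> \<Sum>A"
    using assms by (auto intro!: sum_nonneg)
  ultimately show ?thesis
    by simp
qed

lemma card_signed_sumset_interval_le:
  assumes "1 \<le> k" "h \<in> {1, 2, k}" "h \<le> k"
  shows "int (card (restricted_signed_sumset h {0..<int k}))
    \<le> 2 * (int h * int k - int h ^ 2) + int (h choose 2) + 1"
proof -
  consider "h = 1" | "h = 2" | "h = k"
    using assms(2) by blast
  then show ?thesis
  proof cases
    case 1
    then show ?thesis
      using card_signed_sumset_1_interval_le[OF assms(1)] by simp
  next
    case 2
    then show ?thesis
      using card_signed_sumset_2_interval_le assms(3) by simp
  next
    case 3
    then show ?thesis
      using card_full_signed_sumset_le[of "{0..<int k}"]
      by (simp add: sum_interval_eq_choose power2_eq_square)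
  qed
qed

section \<open>The bound and its sharpness\<close>

theorem theorem3p1:
  shows "(\<forall>(k::nat) (h::nat) (A::int set).
            1 \<le> h \<and> h \<le> k \<and> finite A \<and> card A = k \<and> (\<forall>a\<in>A. 0 \<le> a) \<and> 0 \<in> A \<longrightarrow>
            int (card (restricted_signed_sumset h A))
              \<ge> 2 * (int h * int k - int h ^ 2) + int (h choose 2) + 1) \<and>
         (\<forall>(k::nat) (h::nat).
            1 \<le> k \<and> h \<in> {1, 2, k} \<and> h \<le> k \<longrightarrow>
            (\<exists>A::int set. finite A \<and> card A = k \<and> (\<forall>a\<in>A. 0 \<le> a) \<and> 0 \<in> A \<and>
               int (card (restricted_signed_sumset h A))
                 = 2 * (int h * int k - int h ^ 2) + int (h choose 2) + 1))"
proof (intro conjI allI impI)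
  fix k h :: nat and A :: "int set"
  assume "1 \<le> h \<and> h \<le> k \<and> finite A \<and> card A = k \<and> (\<forall>a\<in>A. 0 \<le> a) \<and> 0 \<in> A"
  then show "2 * (int h * int k - int h ^ 2) + int (h choose 2) + 1
      \<le> int (card (restricted_signed_sumset h A))"
    using card_restricted_signed_sumset_ge[of A h] by blast
next
  fix k h :: nat
  assume kh: "1 \<le> k \<and> h \<in> {1, 2, k} \<and> h \<le> k"
  let ?A = "{0..<int k}"
  have A: "finite ?A" "card ?A = k" "\<forall>a\<in>?A. 0 \<le> a" "0 \<in> ?A"
    using kh by auto
  moreover have "int (card (restricted_signed_sumset h ?A))
      = 2 * (int h * int k - int h ^ 2) + int (h choose 2) + 1"
    using card_signed_sumset_interval_le[of k h] card_restricted_signed_sumset_ge[OF A(1,3,4), of h]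
      kh A(2) by (intro antisym) auto
  ultimately show "\<exists>A::int set. finite A \<and> card A = k \<and> (\<forall>a\<in>A. 0 \<le> a) \<and> 0 \<in> A \<and>
      int (card (restricted_signed_sumset h A))
        = 2 * (int h * int k - int h ^ 2) + int (h choose 2) + 1"
    by blast
qed

end
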